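(* Let $(G_\alpha^t)_{t\ge1}$ be the random graph process of the Simon model with parameter $\alpha\in(0,1)$. For the $i$-th vertex $v_i$ let $t^i_j=\min\{t:\vec d(v_i,t)=j+1\}$, $j=0,1,2,\dots$, and let $W_k^i=t^i_k-t^i_{k-1}$, $k\ge1$. Let $z=\ln\Big(1+\frac{x}{t^i_{k-1}-1}\Big)$, $k\ge1$, $x>0$. It holds $$\Big|\mathbb{P}(W_k^i\le x)-\mathbb{P}(Z_k^i\le z)\Big|<O\Big(\frac{1}{t^i_{k-1}}\Big),$$ where $Z_k^i$ is an exponential random variable of parameter $(1-\alpha)k$.
   Context: Simon model with parameter $\alpha\in(0,1)$: $(G_\alpha^t)_{t\ge1}$ is a random directed (multi)graph process in discrete time. It starts at time $t=1$ with a single vertex $v_1$ and a directed loop. Given $G_\alpha^t$, the graph $G_\alpha^{t+1}$ is formed by either adding, with probability $\alpha$, a new vertex with a directed loop, or adding, with probability $1-\alpha$, a directed edge from the last added vertex to an existing vertex $v_j$ chosen with probability proportional to its in-degree, so that $v_j$ receives the new edge with probability $(1-\alpha)\vec d(v_j,t)/t$. Vertices are numbered $v_1,v_2,\dots$ in order of appearance. $\vec d(v,t)$ is the in-degree of $v$ at time $t$, a directed loop counting one; hence a vertex has in-degree $1$ when it appears. Thus $t_0^i$ is the time of appearance of $v_i$, and $W_k^i$ is the waiting time between the instant at which $v_i$ has in-degree $k$ and that at which it has in-degree $k+1$. The time $t^i_{k-1}$ is regarded as given in the probability $\mathbb{P}(W_k^i\le x)$. The notation $f=O(g)$ means that $\lim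 f/g$ is bounded as the argument tends to infinity. *)

theory Defs
  imports
    "HOL-Probability.Probability"
    "Graph_Theory.Digraph"
begin

text \<open>
  The vertex \<open>v\<^sub>i\<close> is the number \<open>i\<close>. An arc is a triple (label, tail, head); the label is the
  time at which the arc is added, so that parallel arcs are distinct.
\<close>

type_synonym simon_graph = "(nat, nat \<times> nat \<times> nat) pre_digraph"

definition simon_init :: simon_graph where
  "simon_init = \<lparr>verts = {1}, arcs = {(1, 1, 1)},
                  tail = (\<lambda>(e, u, v). u), head = (\<lambda>(e, u, v). v)\<rparr>"

definition simon_add_arc :: "simon_graph \<Rightarrow> nat \<Rightarrow> nat \<Rightarrow> simon_graph" where
  "simon_add_arc g u v = pre_digraph.add_arc g (card (arcs g) + 1, u, v)"

text \<open>\<open>pre_digraph.add_arc\<close> also adds the end points of the arc to the vertex set.\<close>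

definition simon_new_vertex :: "simon_graph \<Rightarrow> simon_graph" where
  "simon_new_vertex g = simon_add_arc g (card (verts g) + 1) (card (verts g) + 1)"

text \<open>As the vertices are \<open>1, \<dots>, n\<close>, the last added one is \<open>card (verts g)\<close>.\<close>

definition simon_new_edge :: "simon_graph \<Rightarrow> nat \<Rightarrow> simon_graph" where
  "simon_new_edge g j = simon_add_arc g (card (verts g)) j"

text \<open>
  The transition probabilities are conditional on the whole history \<open>g 1, \<dots>, g t\<close>, and are
  required only for histories of positive probability, because \<open>cond_prob\<close> is \<open>0\<close> when one
  conditions on a null event. The value \<open>G 0\<close> is irrelevant.
\<close>

locale simon_model = prob_space M
  for M :: "'w measure" +
  fixes \<alpha> :: real and G :: "nat \<Rightarrow> 'w \<Rightarrow> simon_graph"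
  assumes measurable_G: "\<And>t. t \<ge> 1 \<Longrightarrow> G t \<in> measurable M (count_space UNIV)"
    and initial: "AE \<omega> in M. G 1 \<omega> = simon_init"
    and new_vertex:
      "\<And>t g. t \<ge> 1 \<Longrightarrow> \<P>(\<omega> in M. \<forall>s\<in>{1..t}. G s \<omega> = g s) > 0 \<Longrightarrow>
         \<P>(\<omega> in M. G (t + 1) \<omega> = simon_new_vertex (g t) \<bar> \<forall>s\<in>{1..t}. G s \<omega> = g s) = \<alpha>"
    and new_edge:
      "\<And>t g j. t \<ge> 1 \<Longrightarrow> \<P>(\<omega> in M. \<forall>s\<in>{1..t}. G s \<omega> = g s) > 0 \<Longrightarrow> j \<in> verts (g t) \<Longrightarrow>
         \<P>(\<omega> in M. G (t + 1) \<omega> = simon_new_edge (g t) j \<bar> \<forall>s\<in>{1..t}. G s \<omega> = g s)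
           = (1 - \<alpha>) * real (in_degree (g t) j) / real t"

text \<open>The time is infinite if the in-degree \<open>j + 1\<close> is never reached.\<close>

definition hit_time :: "(nat \<Rightarrow> 'w \<Rightarrow> simon_graph) \<Rightarrow> nat \<Rightarrow> nat \<Rightarrow> 'w \<Rightarrow> enat" where
  "hit_time G i j \<omega> = Inf (enat ` {t. t \<ge> 1 \<and> in_degree (G t \<omega>) i = j + 1})"

definition waiting_time :: "(nat \<Rightarrow> 'w \<Rightarrow> simon_graph) \<Rightarrow> nat \<Rightarrow> nat \<Rightarrow> 'w \<Rightarrow> enat" where
  "waiting_time G i k \<omega> = hit_time G i k \<omega> - hit_time G i (k - 1) \<omega>"

end

theory Submission
  imports Defs
begin

text \<open>
  Given \<open>t\<^sub>k\<^sub>-\<^sub>1 = s\<close>, the in-degree of \<open>v\<^sub>i\<close> stays equal to \<open>k\<close> in the step from \<open>m\<close> to \<open>m + 1\<close> with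
  probability \<open>1 - c / m\<close>, where \<open>c = (1 - \<alpha>) k\<close>, whatever the history. Hence the waiting time exceeds
  \<open>n\<close> with probability \<open>\<Prod>m=s..<s+n. 1 - c / m\<close>. The exponential tail at \<open>z\<close> is
  \<open>((s - 1) / (s - 1 + x)) powr c\<close>, which for \<open>x = n\<close> telescopes to \<open>\<Prod>m=s..<s+n. (1 - 1 / m) powr c\<close>.
  Corresponding factors differ by \<open>O(1 / m\<^sup>2)\<close>, which sums to \<open>O(1 / s)\<close> uniformly in \<open>n\<close>, and
  rounding \<open>x\<close> down to an integer costs another \<open>O(1 / s)\<close>.
\<close>

section \<open>The tail product and the exponential tail\<close>

text \<open>The exponential is 1-Lipschitz on the nonpositive half-line, so a gap between exponents
  bounds the gap between exponential tails.\<close>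

lemma exp_diff_le:
  fixes a b :: real
  assumes "a \<le> b" "b \<le> 0"
  shows "exp b - exp a \<le> b - a"
proof -
  have "exp b - exp a = exp b * (1 - exp (a - b))"
    by (simp add: algebra_simps exp_diff)
  also have "\<dots> \<le> 1 * (b - a)"
  proof (rule mult_mono)
    show "1 - exp (a - b) \<le> b - a" using exp_ge_add_one_self[of "a - b"] by linarith
  qed (use assms in auto)
  finally show ?thesis by simp
qed

text \<open>Both terms are compared with \<open>exp (- c * u)\<close>: the first is off by at most
  \<open>(c * u)\<^sup>2\<close>. The second is \<open>exp (c * ln (1 - u))\<close>, and
  \<open>ln (1 - u)\<close> lies between \<open>- u - 2 * u\<^sup>2\<close> and \<open>- u\<close>;
  the lower estimate uses \<open>u \<le> 1/2\<close>.\<close>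

lemma one_minus_powr_approx:
  fixes c u :: real
  assumes "0 \<le> c" "0 \<le> u" "u \<le> 1/2"
  shows "\<bar>(1 - c * u) - (1 - u) powr c\<bar> \<le> (c\<^sup>2 + 2 * c) * u\<^sup>2"
proof -
  define y where "y = c * u"
  have y: "0 \<le> y" using assms by (simp add: y_def)
  have powr: "(1 - u) powr c = exp (c * ln (1 - u))"
    using assms by (simp add: powr_def)
  have "c * (- u - 2 * u\<^sup>2) \<le> c * ln (1 - u)"
    using ln_one_minus_pos_lower_bound[of u] assms by (intro mult_left_mono) auto
  then have lower: "- y - 2 * c * u\<^sup>2 \<le> c * ln (1 - u)"
    by (simp add: y_def algebra_simps)
  have "c * ln (1 - u) \<le> c * (- u)"
    using ln_le_minus_one[of "1 - u"] assms by (intro mult_left_mono) auto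
  then have upper: "c * ln (1 - u) \<le> - y" by (simp add: y_def)
  have "exp (- y) - exp (c * ln (1 - u)) \<le> - y - c * ln (1 - u)"
    using upper y by (intro exp_diff_le) auto
  then have 1: "exp (- y) - (1 - u) powr c \<le> 2 * c * u\<^sup>2"
    using lower powr by simp
  have 2: "(1 - u) powr c \<le> exp (- y)" using upper powr by simp
  \<comment> \<open>The chain ends because \<open>(1 + y) * (1 - y + y\<^sup>2) = 1 + y ^ 3\<close>,
    which is at least 1.\<close>
  have "exp (- y) \<le> 1 / (1 + y)"
    using exp_ge_add_one_self[of y] y by (simp add: exp_minus divide_simps)
  also have "\<dots> \<le> 1 - y + y\<^sup>2"
    using y by (simp add: divide_simps power2_eq_square algebra_simps)
  finally have 3: "exp (- y) \<le> 1 - y + y\<^sup>2" .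
  have 4: "1 - y \<le> exp (- y)" using exp_ge_add_one_self[of "- y"] by simp
  have 5: "y\<^sup>2 = c\<^sup>2 * u\<^sup>2" by (simp add: y_def power_mult_distrib)
  have "0 \<le> c * u\<^sup>2" using assms by simp
  then have "\<bar>(1 - y) - (1 - u) powr c\<bar> \<le> c\<^sup>2 * u\<^sup>2 + 2 * c * u\<^sup>2"
    using 1 2 3 4 5 by (simp only: abs_le_iff) linarith
  then show ?thesis by (simp add: y_def algebra_simps)
qed

lemma prod_shift_powr:
  assumes "s \<ge> 2"
  shows "(\<Prod>m=s..<s+n. (1 - 1 / real m) powr c) = ((real s - 1) / (real s - 1 + real n)) powr c"
proof (induction n)
  case 0
  then show ?case using assms by simp
next
  case (Suc n)
  have "(\<Prod>m=s..<s + Suc n. (1 - 1 / real m) powr c)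
      = ((real s - 1) / (real s - 1 + real n)) powr c * (1 - 1 / real (s + n)) powr c"
    using Suc by simp
  also have "\<dots> = ((real s - 1) / (real s - 1 + real n) * (1 - 1 / real (s + n))) powr c"
    using assms by (intro powr_mult[symmetric])
  also have "(real s - 1) / (real s - 1 + real n) * (1 - 1 / real (s + n))
      = (real s - 1) / (real s - 1 + real (Suc n))"
    using assms by (simp add: divide_simps)
  finally show ?case .
qed

text \<open>Telescoping of \<open>1 / m\<^sup>2 \<le> 1 / (m - 1) - 1 / m\<close>. The subtracted
  term is kept so that the induction closes.\<close>

lemma sum_inverse_squares_le:
  assumes "s \<ge> 2"
  shows "(\<Sum>m=s..<s+n. (1 / real m)\<^sup>2) \<le> 1 / (real s - 1) - 1 / (real s + real n - 1)"
proof (induction n)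
  case 0
  then show ?case by simp
next
  case (Suc n)
  define y where "y = real s + real n"
  have y: "y \<ge> 2" using assms by (simp add: y_def)
  have "(1 / y)\<^sup>2 \<le> 1 / (y - 1) - 1 / y"
    using y by (simp add: divide_simps power2_eq_square)
  then show ?case using Suc by (simp add: y_def)
qed

text \<open>The condition \<open>c \<le> real s\<close> puts every factor \<open>1 - c / m\<close>
  into [0,1]. In the constant, \<open>c\<^sup>2 + 2 * c\<close> comes from comparing factors, one
  more \<open>c\<close> from rounding \<open>x\<close>, and the 2 from
  \<open>1 / (s - 1) \<le> 2 / s\<close>.\<close>

lemma prod_approx_exponential_tail:
  assumes "0 \<le> c" "c \<le> real s" "s \<ge> 2" "0 < x"
  shows "\<bar>(\<Prod>m=s..<s + nat \<lfloor>x\<rfloor>. 1 - c / real m) - exp (- ln (1 + x / (real s - 1)) * c)\<bar>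
          \<le> 2 * (c\<^sup>2 + 3 * c) / real s"
proof -
  define n where "n = nat \<lfloor>x\<rfloor>"
  define y where "y = real s - 1"
  have y: "y \<ge> 1" using assms by (simp add: y_def)
  have n: "real n \<le> x" "x < real n + 1"
    using assms by (auto simp: n_def)
  have D: "c\<^sup>2 + 2 * c \<ge> 0" using assms by simp
  \<comment> \<open>Two products of factors of absolute value at most 1 differ by at most the sum of
    the differences of the factors.\<close>
  have "\<bar>(\<Prod>m=s..<s+n. 1 - c / real m) - (\<Prod>m=s..<s+n. (1 - 1 / real m) powr c)\<bar>
      \<le> (\<Sum>m=s..<s+n. \<bar>(1 - c / real m) - (1 - 1 / real m) powr c\<bar>)"
  proof (rule norm_prod_diff[where 'a = real, unfolded real_norm_def])
    fix m assume "m \<in> {s..<s+n}"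
    then have m: "m \<ge> s" by simp
    then have "0 \<le> c / real m" "c / real m \<le> 1" using assms by (auto simp: divide_simps)
    then show "\<bar>1 - c / real m\<bar> \<le> 1" by simp
    have "(1 - 1 / real m) powr c \<le> 1"
      using m assms by (intro powr_le1) (auto simp: divide_simps)
    then show "\<bar>(1 - 1 / real m) powr c\<bar> \<le> 1" by simp
  qed
  also have "\<dots> \<le> (\<Sum>m=s..<s+n. (c\<^sup>2 + 2 * c) * (1 / real m)\<^sup>2)"
  proof (rule sum_mono)
    fix m assume "m \<in> {s..<s+n}"
    then have "m \<ge> 2" using assms by simp
    then show "\<bar>(1 - c / real m) - (1 - 1 / real m) powr c\<bar> \<le> (c\<^sup>2 + 2 * c) * (1 / real m)\<^sup>2"
      using one_minus_powr_approx[of c "1 / real m"] assms by (simp add: divide_simps)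
  qed
  also have "\<dots> = (c\<^sup>2 + 2 * c) * (\<Sum>m=s..<s+n. (1 / real m)\<^sup>2)"
    by (simp add: sum_distrib_left)
  also have "\<dots> \<le> (c\<^sup>2 + 2 * c) * (1 / y)"
  proof (rule mult_left_mono[OF _ D])
    have "1 / (real s + real n - 1) \<ge> 0" using assms by simp
    then show "(\<Sum>m=s..<s+n. (1 / real m)\<^sup>2) \<le> 1 / y"
      using sum_inverse_squares_le[OF \<open>s \<ge> 2\<close>, of n] unfolding y_def by linarith
  qed
  finally have 1: "\<bar>(\<Prod>m=s..<s+n. 1 - c / real m) - (\<Prod>m=s..<s+n. (1 - 1 / real m) powr c)\<bar>
      \<le> (c\<^sup>2 + 2 * c) / y" by simp
  \<comment> \<open>The exponential tail at \<open>ln (1 + w / y)\<close>. The product of powers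
    equals \<open>E (real n)\<close>, which leaves only the passage from \<open>n\<close> to
    \<open>x\<close>.\<close>
  define E where "E w = exp (- c * ln (1 + w / y))" for w
  have "(\<Prod>m=s..<s+n. (1 - 1 / real m) powr c) = (y / (y + real n)) powr c"
    using prod_shift_powr[OF \<open>s \<ge> 2\<close>] by (simp add: y_def)
  also have "\<dots> = exp (c * ln (y / (y + real n)))" using y by (simp add: powr_def)
  also have "ln (y / (y + real n)) = - ln (1 + real n / y)"
    using y by (simp add: ln_div add_divide_eq_if_simps(1) field_simps)
  finally have En: "(\<Prod>m=s..<s+n. (1 - 1 / real m) powr c) = E (real n)" by (simp add: E_def)
  have pos: "1 + real n / y > 0" "1 + x / y > 0"
    using y assms by (auto intro!: add_pos_nonneg)
  have mono: "ln (1 + real n / y) \<le> ln (1 + x / y)"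
    using n y pos by (simp add: divide_right_mono)
  have nonneg: "0 \<le> ln (1 + real n / y)" using y by simp
  \<comment> \<open>Writing the difference as one logarithm and using
    \<open>ln a \<le> a - 1\<close> leaves \<open>x - n < 1\<close> in the numerator.\<close>
  have "ln (1 + x / y) - ln (1 + real n / y) = ln ((1 + x / y) / (1 + real n / y))"
    using pos by (simp add: ln_div)
  also have "\<dots> \<le> (1 + x / y) / (1 + real n / y) - 1"
    using pos by (intro ln_le_minus_one) simp
  also have "\<dots> = (x - real n) / (y + real n)"
  proof -
    have "y + real n > 0" "y > 0" using y by auto
    then show ?thesis by (simp add: divide_simps)
  qed
  also have "\<dots> \<le> 1 / y"
    using n y by (intro frac_le) auto
  finally have "c * (ln (1 + x / y) - ln (1 + real n / y)) \<le> c * (1 / y)"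
    using assms by (intro mult_left_mono) auto
  moreover have "E (real n) - E x \<le> c * (ln (1 + x / y) - ln (1 + real n / y))"
    using exp_diff_le[of "- c * ln (1 + x / y)" "- c * ln (1 + real n / y)"] mono nonneg assms
    by (simp add: E_def mult_left_mono algebra_simps)
  moreover have "E x \<le> E (real n)"
    using mono assms by (simp add: E_def mult_left_mono)
  ultimately have 2: "\<bar>E (real n) - E x\<bar> \<le> c / y" by simp
  have "\<bar>(\<Prod>m=s..<s+n. 1 - c / real m) - E x\<bar> \<le> (c\<^sup>2 + 2 * c) / y + c / y"
    using 1 2 unfolding En by linarith
  also have "\<dots> = (c\<^sup>2 + 3 * c) * (1 / y)" by (simp flip: add_divide_distrib)
  also have "\<dots> \<le> (c\<^sup>2 + 3 * c) * (2 / real s)"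
    using assms by (intro mult_left_mono) (auto simp: y_def divide_simps)
  finally show ?thesis by (simp add: E_def n_def y_def mult_ac)
qed

section \<open>Reachable graphs\<close>

text \<open>A single index covers all transitions: with n vertices present, \<open>n + 1\<close>
  stands for the new vertex and a smaller \<open>j\<close> for an edge to \<open>j\<close>. In both
  cases \<open>j\<close> is the head of the new arc.\<close>

definition simon_next :: "simon_graph \<Rightarrow> nat \<Rightarrow> simon_graph" where
  "simon_next g j = (if j = card (verts g) + 1 then simon_new_vertex g else simon_new_edge g j)"

definition simon_succ :: "simon_graph \<Rightarrow> simon_graph set" where
  "simon_succ g = simon_next g ` {1..card (verts g) + 1}"

text \<open>The index is shifted by one: \<open>simon_states n\<close> contains the graphs possible
  at time \<open>n + 1\<close>. Finiteness of these sets turns conditioning on histories into finite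
  sums.\<close>

primrec simon_states :: "nat \<Rightarrow> simon_graph set" where
  "simon_states 0 = {simon_init}"
| "simon_states (Suc n) = (\<Union>g\<in>simon_states n. simon_succ g)"

lemma finite_simon_states: "finite (simon_states n)"
  by (induction n) (auto simp: simon_succ_def)

text \<open>Invariant of the graph at time \<open>t\<close>. The maps \<open>tail\<close> and
  \<open>head\<close> are fixed because they are fields of the record; the bound on labels makes the
  label \<open>t + 1\<close> fresh, and heads lying in \<open>verts g\<close> let in-degrees count
  all arcs.\<close>

definition simon_shape :: "nat \<Rightarrow> simon_graph \<Rightarrow> bool" where
  "simon_shape t g \<longleftrightarrow>
     tail g = (\<lambda>(e, u, v). u) \<and> head g = (\<lambda>(e, u, v). v) \<and>
     verts g = {1..card (verts g)} \<and> verts g \<noteq> {} \<and>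
     finite (arcs g) \<and> card (arcs g) = t \<and>
     (\<forall>(e, u, v)\<in>arcs g. e \<le> t \<and> v \<in> verts g)"

lemma simon_shape_init: "simon_shape 1 simon_init"
  by (auto simp: simon_shape_def simon_init_def)

text \<open>Both kinds of transition take one form because the last vertex is already present, so
  inserting it as a tail changes nothing.\<close>

lemma simon_next_eq:
  assumes "simon_shape t g" "j \<in> {1..card (verts g) + 1}"
  shows "simon_next g j =
    \<lparr>verts = insert j (verts g), arcs = insert (t + 1, if j = card (verts g) + 1 then j else card (verts g), j) (arcs g),
     tail = (\<lambda>(e, u, v). u), head = (\<lambda>(e, u, v). v)\<rparr>"
proof -
  have sh: "tail g = (\<lambda>(e, u, v). u)" "head g = (\<lambda>(e, u, v). v)" "verts g = {1..card (verts g)}"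
    "verts g \<noteq> {}" "card (arcs g) = t"
    using assms(1) unfolding simon_shape_def by auto
  have "card (verts g) \<ge> 1" using sh(3,4) by (cases "card (verts g)") auto
  then have "card (verts g) \<in> verts g" by (subst sh(3)) simp
  then show ?thesis
    using sh(1,2,5)
    by (auto simp: simon_next_def simon_new_vertex_def simon_new_edge_def simon_add_arc_def
        pre_digraph.add_arc_def)
qed

lemma fresh_arc:
  assumes "simon_shape t g"
  shows "(t + 1, p) \<notin> arcs g"
  using assms unfolding simon_shape_def by (cases p) fastforce

lemma simon_shape_next:
  assumes sh: "simon_shape t g" and j: "j \<in> {1..card (verts g) + 1}"
  shows "simon_shape (t + 1) (simon_next g j)"
proof -
  define n where "n = card (verts g)"
  have g: "verts g = {1..n}" "finite (arcs g)" "card (arcs g) = t"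
    "\<And>e u v. (e, u, v) \<in> arcs g \<Longrightarrow> e \<le> t \<and> v \<in> {1..n}"
    using sh unfolding simon_shape_def n_def by fastforce+
  \<comment> \<open>The vertices remain an initial segment, since \<open>j\<close> is either present
    or the next number.\<close>
  have "insert j {1..n} = {1..if j = n + 1 then n + 1 else n}"
    using j by (auto simp: n_def)
  then have v: "insert j {1..n} = {1..card (insert j {1..n})}" by simp
  show ?thesis
    unfolding simon_shape_def simon_next_eq[OF sh j] n_def[symmetric]
    using g v fresh_arc[OF sh] by (fastforce simp: simon_shape_def)
qed

lemma simon_shape_states: "g \<in> simon_states n \<Longrightarrow> simon_shape (Suc n) g"
proof (induction n arbitrary: g)
  case 0
  then show ?case using simon_shape_init by simp
next
  case (Suc n)
  then show ?case using simon_shape_next by (fastforce simp: simon_succ_def)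
qed

text \<open>The only new arc is fresh and has head \<open>j\<close>. For a new vertex this is the
  loop, raising its in-degree from 0 to 1.\<close>

lemma in_degree_simon_next:
  assumes sh: "simon_shape t g" and j: "j \<in> {1..card (verts g) + 1}"
  shows "in_degree (simon_next g j) i = in_degree g i + (if i = j then 1 else 0)"
proof -
  define a where "a = (t + 1, if j = card (verts g) + 1 then j else card (verts g), j)"
  have h: "head g = (\<lambda>(e, u, v). v)" and fin: "finite (arcs g)"
    using sh unfolding simon_shape_def by auto
  have "in_arcs (simon_next g j) i = (if i = j then insert a (in_arcs g i) else in_arcs g i)"
    unfolding in_arcs_def simon_next_eq[OF sh j] a_def[symmetric] h by (auto simp: a_def)
  moreover have "card (insert a (in_arcs g i)) = card (in_arcs g i) + 1"
  proof -
    have "a \<notin> in_arcs g i" "finite (in_arcs g i)"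
      using fresh_arc[OF sh] fin by (simp_all add: a_def in_arcs_def)
    then show ?thesis by simp
  qed
  ultimately show ?thesis unfolding in_degree_def by (cases "i = j") simp_all
qed

text \<open>The in-degree of \<open>j\<close> reveals whether \<open>j\<close> was chosen. Hence
  different choices are disjoint events.\<close>

lemma inj_on_simon_next:
  assumes "simon_shape t g"
  shows "inj_on (simon_next g) {1..card (verts g) + 1}"
proof (rule inj_onI)
  fix j j' assume *: "j \<in> {1..card (verts g) + 1}" "j' \<in> {1..card (verts g) + 1}"
    "simon_next g j = simon_next g j'"
  have "in_degree (simon_next g j) j = in_degree g j + 1"
    using in_degree_simon_next[OF assms *(1), of j] by simp
  then have "in_degree g j + (if j = j' then 1 else 0) = in_degree g j + 1"
    unfolding *(3) in_degree_simon_next[OF assms *(2)] .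
  then show "j = j'" by (simp split: if_splits)
qed

text \<open>The arcs are partitioned by their heads. This is what makes the transition probabilities
  add up to 1.\<close>

lemma sum_in_degree:
  assumes "simon_shape t g"
  shows "(\<Sum>v\<in>verts g. in_degree g v) = t"
proof -
  have fin: "finite (arcs g)" "card (arcs g) = t" and h: "head g = (\<lambda>(e, u, v). v)"
    and v: "verts g = {1..card (verts g)}" and a: "\<forall>(e, u, v)\<in>arcs g. e \<le> t \<and> v \<in> verts g"
    using assms unfolding simon_shape_def by auto
  have fv: "finite (verts g)" by (subst v) simp
  have "(\<Sum>v\<in>verts g. in_degree g v) = card (\<Union>v\<in>verts g. in_arcs g v)"
    unfolding in_degree_def using fin fv
    by (intro card_UN_disjoint[symmetric]) (auto simp: in_arcs_def)
  also have "(\<Union>v\<in>verts g. in_arcs g v) = arcs g"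
    using a h by (fastforce simp: in_arcs_def)
  finally show ?thesis using fin by simp
qed

lemma in_degree_le:
  assumes "simon_shape t g"
  shows "in_degree g i \<le> t"
proof -
  have "finite (arcs g)" "card (arcs g) = t"
    using assms unfolding simon_shape_def by auto
  moreover have "in_arcs g i \<subseteq> arcs g" by (auto simp: in_arcs_def)
  ultimately show ?thesis unfolding in_degree_def using card_mono by blast
qed

lemma in_degree_pos_imp_vertex:
  assumes "simon_shape t g" "in_degree g i > 0"
  shows "i \<in> verts g"
proof -
  obtain e where "e \<in> in_arcs g i"
    using assms(2) unfolding in_degree_def by (metis card_gt_0_iff ex_in_conv)
  then show ?thesis
    using assms(1) unfolding simon_shape_def in_arcs_def by fastforce
qed

section \<open>Hitting times\<close>

lemma hit_time_le_iff:
  "hit_time G i j \<omega> \<le> enat n \<longleftrightarrow> (\<exists>m\<in>{1..n}. in_degree (G m \<omega>) i = j + 1)"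
proof
  let ?A = "enat ` {t. t \<ge> 1 \<and> in_degree (G t \<omega>) i = j + 1}"
  assume le: "hit_time G i j \<omega> \<le> enat n"
  \<comment> \<open>An empty set has infimum \<infinity>, which exceeds \<open>enat n\<close>; over
    a nonempty set the infimum is attained.\<close>
  have "?A \<noteq> {}"
  proof
    assume "?A = {}"
    then have "hit_time G i j \<omega> = \<infinity>" by (simp only: hit_time_def Inf_enat_def simp_thms if_True)
    then show False using le by simp
  qed
  then obtain a where "a \<in> ?A" by blast
  then have "Inf ?A \<in> ?A" unfolding Inf_enat_def using LeastI[of "\<lambda>x. x \<in> ?A" a] by auto
  then show "\<exists>m\<in>{1..n}. in_degree (G m \<omega>) i = j + 1"
    using le unfolding hit_time_def by auto
next
  assume "\<exists>m\<in>{1..n}. in_degree (G m \<omega>) i = j + 1"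
  then obtain m where m: "m \<in> {1..n}" "in_degree (G m \<omega>) i = j + 1" by auto
  then have "hit_time G i j \<omega> \<le> enat m"
    unfolding hit_time_def by (intro Inf_lower) auto
  also have "\<dots> \<le> enat n" using m by simp
  finally show "hit_time G i j \<omega> \<le> enat n" .
qed

text \<open>Expresses the event through the graphs at times \<open>1, ..., s\<close> alone, which
  yields its measurability and its dependence on a finite history.\<close>

lemma hit_time_eq_iff:
  assumes "s \<ge> 1"
  shows "hit_time G i j \<omega> = enat s \<longleftrightarrow>
    in_degree (G s \<omega>) i = j + 1 \<and> (\<forall>m\<in>{1..<s}. in_degree (G m \<omega>) i \<noteq> j + 1)"
proof -
  have "hit_time G i j \<omega> = enat s \<longleftrightarrow> hit_time G i j \<omega> \<le> enat s \<and> \<not> hit_time G i j \<omega> \<le> enat (s - 1)"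
    using assms by (cases "hit_time G i j \<omega>") auto
  also have "\<dots> \<longleftrightarrow> in_degree (G s \<omega>) i = j + 1 \<and> (\<forall>m\<in>{1..<s}. in_degree (G m \<omega>) i \<noteq> j + 1)"
  proof -
    have "{1..s} = insert s {1..<s}" "{1..s - 1} = {1..<s}" using assms by auto
    then show ?thesis unfolding hit_time_le_iff by auto
  qed
  finally show ?thesis .
qed

text \<open>A natural number is at most \<open>x\<close> iff it is at most the floor of
  \<open>x\<close>. Truncated subtraction does no harm: for \<open>m < s\<close> both sides are
  true.\<close>

lemma waiting_time_le_iff:
  assumes "hit_time G i (k - 1) \<omega> = enat s" "0 < x"
  shows "ereal_of_enat (waiting_time G i k \<omega>) \<le> ereal x \<longleftrightarrow>
    hit_time G i k \<omega> \<le> enat (s + nat \<lfloor>x\<rfloor>)"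
proof (cases "hit_time G i k \<omega>")
  case (enat m)
  have "real (m - s) \<le> x \<longleftrightarrow> m - s \<le> nat \<lfloor>x\<rfloor>"
    using assms(2) by (simp add: le_nat_floor le_floor_iff nat_le_iff le_nat_iff)
  then show ?thesis
    using assms(1) enat by (auto simp: waiting_time_def)
next
  case infinity
  then show ?thesis using assms(1) by (simp add: waiting_time_def)
qed

text \<open>Along a path the in-degree rises by 0 or 1 per step. It therefore cannot leave
  \<open>k\<close> without taking the value \<open>k + 1\<close>, and it cannot have been
  \<open>k + 1\<close> before time \<open>s\<close>.\<close>

lemma hit_time_gt_iff:
  assumes path: "\<And>t. t \<ge> 1 \<Longrightarrow> simon_shape t (G t \<omega>) \<and> G (t + 1) \<omega> \<in> simon_succ (G t \<omega>)"
    and "s \<ge> 1" and deg: "in_degree (G s \<omega>) i = k"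
  shows "\<not> hit_time G i k \<omega> \<le> enat (s + n) \<longleftrightarrow> (\<forall>m\<in>{s..s+n}. in_degree (G m \<omega>) i = k)"
proof -
  define d where "d m = in_degree (G m \<omega>) i" for m
  have step: "d (t + 1) = d t \<or> d (t + 1) = d t + 1" if "t \<ge> 1" for t
    using path[OF that] in_degree_simon_next[of t "G t \<omega>"] by (auto simp: simon_succ_def d_def)
  have mono: "1 \<le> a \<Longrightarrow> a \<le> b \<Longrightarrow> d a \<le> d b" for a b
  proof (induction b)
    case (Suc b)
    then show ?case using step[of b] by (cases "a = Suc b") auto
  qed simp
  show ?thesis unfolding hit_time_le_iff d_def[symmetric]
  proof
    assume *: "\<not> (\<exists>m\<in>{1..s+n}. d m = k + 1)"
    have "m \<le> n \<Longrightarrow> d (s + m) = k" for m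
    proof (induction m)
      case 0
      then show ?case using deg by (simp add: d_def)
    next
      case (Suc m)
      moreover have "d (s + m + 1) \<noteq> k + 1" using * Suc.prems \<open>s \<ge> 1\<close> by auto
      ultimately show ?case using step[of "s + m"] \<open>s \<ge> 1\<close> by auto
    qed
    then show "\<forall>m\<in>{s..s+n}. d m = k"
      by (metis add_le_cancel_left atLeastAtMost_iff le_Suc_ex)
  next
    assume *: "\<forall>m\<in>{s..s+n}. d m = k"
    show "\<not> (\<exists>m\<in>{1..s+n}. d m = k + 1)"
    proof
      assume "\<exists>m\<in>{1..s+n}. d m = k + 1"
      then obtain m where m: "m \<in> {1..s+n}" "d m = k + 1" by auto
      show False
      proof (cases "m \<le> s")
        case True
        then have "d m \<le> d s" using mono[of m s] m by simp
        then show False using m deg by (simp add: d_def)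
      next
        case False
        then show False using * m by auto
      qed
    qed
  qed
qed

section \<open>Conditioning on the history\<close>

context simon_model
begin

section \<open>Measurability and decomposition over finitely many histories\<close>

lemma events_at: "t \<ge> 1 \<Longrightarrow> {\<omega> \<in> space M. P (G t \<omega>)} \<in> events"
  using measurable_sets[OF measurable_G, of t "Collect P"]
  by (simp add: vimage_def Int_def conj_commute)

lemma events_Ball:
  assumes "finite I" "\<And>m. m \<in> I \<Longrightarrow> m \<ge> 1"
  shows "{\<omega> \<in> space M. \<forall>m\<in>I. P m (G m \<omega>)} \<in> events"
  using assms by (intro sets.sets_Collect_finite_All events_at)

lemma events_history: "{\<omega> \<in> space M. \<forall>s\<in>{1..t}. G s \<omega> = g s} \<in> events"
  by (rule events_Ball) auto

text \<open>Almost surely the history is one of finitely many functions on \<open>{1..t}\<close>.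
  Taking them extensional counts each history once, so the events are disjoint.\<close>

lemma history_sum:
  assumes "AE \<omega> in M. \<forall>s\<in>{1..t}. G s \<omega> \<in> S s" and "\<And>s. finite (S s)"
    and Q: "{\<omega> \<in> space M. Q \<omega>} \<in> events"
  shows "\<P>(\<omega> in M. Q \<omega>) = (\<Sum>g\<in>PiE {1..t} S. \<P>(\<omega> in M. (\<forall>s\<in>{1..t}. G s \<omega> = g s) \<and> Q \<omega>))"
proof -
  define A where "A g = {\<omega> \<in> space M. (\<forall>s\<in>{1..t}. G s \<omega> = g s) \<and> Q \<omega>}" for g
  have fin: "finite (PiE {1..t} S)" using assms(2) by (intro finite_PiE) auto
  have A: "A g \<in> events" for g
  proof -
    have "A g = {\<omega> \<in> space M. \<forall>s\<in>{1..t}. G s \<omega> = g s} \<inter> {\<omega> \<in> space M. Q \<omega>}"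
      by (auto simp: A_def)
    then show ?thesis using events_history Q by simp
  qed
  have "prob {\<omega> \<in> space M. Q \<omega>} = prob (\<Union>g\<in>PiE {1..t} S. A g)"
  proof (rule finite_measure_eq_AE)
    show "AE \<omega> in M. (\<omega> \<in> {\<omega> \<in> space M. Q \<omega>}) = (\<omega> \<in> (\<Union>g\<in>PiE {1..t} S. A g))"
      using assms(1)
    proof eventually_elim
      case (elim \<omega>)
      define h where "h = (\<lambda>s\<in>{1..t}. G s \<omega>)"
      have "h \<in> PiE {1..t} S" using elim unfolding h_def by (intro restrict_PiE_iff[THEN iffD2])
      moreover have "\<omega> \<in> space M \<Longrightarrow> Q \<omega> \<Longrightarrow> \<omega> \<in> A h" by (simp add: A_def h_def)
      moreover have "\<omega> \<in> A g \<Longrightarrow> \<omega> \<in> space M \<and> Q \<omega>" for g by (simp add: A_def)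
      ultimately show ?case by blast
    qed
  qed (use Q A fin in auto)
  also have "\<dots> = (\<Sum>g\<in>PiE {1..t} S. prob (A g))"
  proof (rule finite_measure_finite_Union[OF fin])
    show "A ` PiE {1..t} S \<subseteq> events" using A by auto
    show "disjoint_family_on A (PiE {1..t} S)"
    proof (unfold disjoint_family_on_def, intro ballI impI)
      fix g h assume gh: "g \<in> PiE {1..t} S" "h \<in> PiE {1..t} S" "g \<noteq> h"
      show "A g \<inter> A h = {}"
      proof (rule ccontr)
        assume "A g \<inter> A h \<noteq> {}"
        then have "\<forall>s\<in>{1..t}. g s = h s" by (auto simp: A_def)
        then have "g = h" using gh by (intro PiE_ext) auto
        then show False using gh by simp
      qed
    qed
  qed
  finally show ?thesis by (simp add: A_def)
qed

section \<open>Transition probabilities and almost sure paths\<close>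

lemma prob_next:
  assumes t: "t \<ge> 1" and sh: "simon_shape t (g t)" and j: "j \<in> {1..card (verts (g t)) + 1}"
  shows "\<P>(\<omega> in M. (\<forall>s\<in>{1..t}. G s \<omega> = g s) \<and> G (t + 1) \<omega> = simon_next (g t) j)
    = (if j = card (verts (g t)) + 1 then \<alpha> else (1 - \<alpha>) * real (in_degree (g t) j) / real t)
      * \<P>(\<omega> in M. \<forall>s\<in>{1..t}. G s \<omega> = g s)"
    (is "?l = ?p * ?H")
proof (cases "?H > 0")
  case True
  have "cond_prob M (\<lambda>\<omega>. G (t + 1) \<omega> = simon_next (g t) j) (\<lambda>\<omega>. \<forall>s\<in>{1..t}. G s \<omega> = g s) = ?p"
  proof (cases "j = card (verts (g t)) + 1")
    case j': True
    then show ?thesis using new_vertex[OF t True] by (simp add: simon_next_def)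
  next
    case False
    have "verts (g t) = {1..card (verts (g t))}" using sh unfolding simon_shape_def by blast
    moreover have "j \<in> {1..card (verts (g t))}" using False j by auto
    ultimately have "j \<in> verts (g t)" by blast
    then show ?thesis using new_edge[OF t True, of j] False by (simp add: simon_next_def)
  qed
  then show ?thesis
    using True unfolding cond_prob_def by (simp add: conj_commute field_simps)
next
  \<comment> \<open>For a null history both sides vanish, so the equation holds for every history
    and can be summed.\<close>
  case False
  then have H0: "?H = 0" by (simp add: zero_less_measure_iff)
  have "?l \<le> ?H" by (rule finite_measure_mono) (use events_history in auto)
  then show ?thesis using H0 by (simp add: measure_le_0_iff)
qed

text \<open>The transitions are disjoint and their probabilities sum to
  \<open>\<alpha> + (1 - \<alpha>) * t / t = 1\<close>. The model prescribes only single
  transitions; that almost surely nothing else happens follows from this sum.\<close>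

lemma prob_succ:
  assumes t: "t \<ge> 1" and sh: "simon_shape t (g t)"
  shows "\<P>(\<omega> in M. (\<forall>s\<in>{1..t}. G s \<omega> = g s) \<and> G (t + 1) \<omega> \<in> simon_succ (g t))
    = \<P>(\<omega> in M. \<forall>s\<in>{1..t}. G s \<omega> = g s)"
proof -
  let ?n = "card (verts (g t))"
  let ?H = "\<P>(\<omega> in M. \<forall>s\<in>{1..t}. G s \<omega> = g s)"
  let ?p = "\<lambda>j. if j = ?n + 1 then \<alpha> else (1 - \<alpha>) * real (in_degree (g t) j) / real t"
  define A where "A j = {\<omega> \<in> space M. (\<forall>s\<in>{1..t}. G s \<omega> = g s) \<and> G (t + 1) \<omega> = simon_next (g t) j}" for j
  have v: "verts (g t) = {1..?n}" using sh unfolding simon_shape_def by blast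
  have "{\<omega> \<in> space M. (\<forall>s\<in>{1..t}. G s \<omega> = g s) \<and> G (t + 1) \<omega> \<in> simon_succ (g t)}
      = (\<Union>j\<in>{1..?n + 1}. A j)"
    by (auto simp: A_def simon_succ_def)
  also have "prob \<dots> = (\<Sum>j\<in>{1..?n + 1}. prob (A j))"
  proof (rule finite_measure_finite_Union)
    show "A ` {1..?n + 1} \<subseteq> events" unfolding A_def using t by (intro image_subsetI sets.sets_Collect_conj events_history events_at) auto
    show "disjoint_family_on A {1..?n + 1}"
      using inj_on_simon_next[OF sh] by (auto simp: disjoint_family_on_def A_def inj_on_def)
  qed simp
  also have "\<dots> = (\<Sum>j\<in>{1..?n + 1}. ?p j * ?H)"
    unfolding A_def using prob_next[where g = g, OF t sh] by (intro sum.cong) auto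
  also have "\<dots> = (\<Sum>j\<in>{1..?n + 1}. ?p j) * ?H" by (simp only: sum_distrib_right)
  also have "(\<Sum>j\<in>{1..?n + 1}. ?p j) = \<alpha> + (\<Sum>j\<in>{1..?n}. ?p j)"
    by simp
  also have "(\<Sum>j\<in>{1..?n}. ?p j) = (\<Sum>j\<in>{1..?n}. (1 - \<alpha>) * real (in_degree (g t) j) / real t)"
    by (intro sum.cong) auto
  also have "\<dots> = (1 - \<alpha>) * real (\<Sum>j\<in>{1..?n}. in_degree (g t) j) / real t"
    by (simp add: sum_distrib_left sum_divide_distrib)
  also have "(\<Sum>j\<in>{1..?n}. in_degree (g t) j) = t"
    using sum_in_degree[OF sh] v by simp
  finally show ?thesis using t by simp
qed

lemma AE_succ_of_AE_states:
  assumes t: "t \<ge> 1" and AE: "AE \<omega> in M. \<forall>s\<in>{1..t}. G s \<omega> \<in> simon_states (s - 1)"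
  shows "AE \<omega> in M. G (t + 1) \<omega> \<in> simon_succ (G t \<omega>)"
proof -
  let ?S = "PiE {1..t} (\<lambda>s. simon_states (s - 1))"
  \<comment> \<open>Restricting \<open>G t\<close> to a finite set of states makes the event a
    finite union of measurable events.\<close>
  let ?Q = "\<lambda>\<omega>. G (t + 1) \<omega> \<in> simon_succ (G t \<omega>) \<and> G t \<omega> \<in> simon_states (t - 1)"
  have "{\<omega> \<in> space M. ?Q \<omega>}
      = (\<Union>g\<in>simon_states (t - 1). {\<omega> \<in> space M. G t \<omega> = g \<and> G (t + 1) \<omega> \<in> simon_succ g})"
    by auto
  also have "\<dots> \<in> events"
    using t finite_simon_states by (intro sets.finite_UN sets.sets_Collect_conj events_at) auto
  finally have m: "{\<omega> \<in> space M. ?Q \<omega>} \<in> events" .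
  have "\<P>(\<omega> in M. ?Q \<omega>) = (\<Sum>g\<in>?S. \<P>(\<omega> in M. (\<forall>s\<in>{1..t}. G s \<omega> = g s) \<and> ?Q \<omega>))"
    by (rule history_sum[OF AE finite_simon_states m])
  \<comment> \<open>The conjunct \<open>True\<close> gives the sum the form of
    \<open>history_sum\<close> for the sure event, so that it can be folded back to 1.\<close>
  also have "\<dots> = (\<Sum>g\<in>?S. \<P>(\<omega> in M. (\<forall>s\<in>{1..t}. G s \<omega> = g s) \<and> True))"
  proof (rule sum.cong[OF refl])
    fix g assume g: "g \<in> ?S"
    then have gt: "g t \<in> simon_states (t - 1)" using t by auto
    then have sh: "simon_shape t (g t)" using simon_shape_states[of "g t" "t - 1"] t by simp
    have "{\<omega> \<in> space M. (\<forall>s\<in>{1..t}. G s \<omega> = g s) \<and> ?Q \<omega>}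
        = {\<omega> \<in> space M. (\<forall>s\<in>{1..t}. G s \<omega> = g s) \<and> G (t + 1) \<omega> \<in> simon_succ (g t)}"
      using gt t by auto
    then show "\<P>(\<omega> in M. (\<forall>s\<in>{1..t}. G s \<omega> = g s) \<and> ?Q \<omega>)
        = \<P>(\<omega> in M. (\<forall>s\<in>{1..t}. G s \<omega> = g s) \<and> True)"
      using prob_succ[where g = g, OF t sh] by simp
  qed
  also have "\<dots> = \<P>(\<omega> in M. True)"
    by (rule history_sum[OF AE finite_simon_states, symmetric]) simp
  also have "\<dots> = 1" by (simp add: prob_space)
  finally have "AE \<omega> in M. ?Q \<omega>" using prob_Collect_eq_1[OF m] by simp
  then show ?thesis by eventually_elim simp
qed

text \<open>Induction in alternation with \<open>AE_succ_of_AE_states\<close>: reachability up to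
  \<open>t\<close> gives a successor at \<open>t + 1\<close>, which is again reachable.\<close>

lemma AE_states: "AE \<omega> in M. \<forall>s\<in>{1..t}. G s \<omega> \<in> simon_states (s - 1)"
proof (induction t)
  case (Suc t)
  show ?case
  proof (cases "t = 0")
    case True
    then show ?thesis using initial by simp
  next
    case False
    then have t: "t \<ge> 1" by simp
    show ?thesis using AE_succ_of_AE_states[OF t Suc] Suc
    proof eventually_elim
      case (elim \<omega>)
      then have "G t \<omega> \<in> simon_states (t - 1)" using t by simp
      then have "G (t + 1) \<omega> \<in> simon_states (Suc (t - 1))" using elim by auto
      then have "G (Suc t) \<omega> \<in> simon_states (Suc t - 1)" using t by simp
      then show ?case using elim by (auto simp: le_Suc_eq)
    qed
  qed
qed simp

lemma AE_path:
  "AE \<omega> in M. \<forall>t\<ge>1. simon_shape t (G t \<omega>) \<and> G (t + 1) \<omega> \<in> simon_succ (G t \<omega>)"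
proof -
  have "AE \<omega> in M. t \<ge> 1 \<longrightarrow> simon_shape t (G t \<omega>) \<and> G (t + 1) \<omega> \<in> simon_succ (G t \<omega>)" for t
  proof (cases "t \<ge> 1")
    case True
    show ?thesis using AE_succ_of_AE_states[OF True AE_states] AE_states[of t]
    proof eventually_elim
      case (elim \<omega>)
      then have "G t \<omega> \<in> simon_states (t - 1)" using True by simp
      then have "simon_shape t (G t \<omega>)" using simon_shape_states[of "G t \<omega>" "t - 1"] True by simp
      then show ?case using elim by simp
    qed
  qed simp
  then show ?thesis by (simp add: AE_all_countable)
qed

text \<open>\<open>P\<close> stands for a property of the history up to \<open>t\<close> that forces
  in-degree \<open>k\<close>. Every such history has the same probability
  \<open>(1 - \<alpha>) * k / t\<close> of an edge to \<open>i\<close>, so the factor comes out of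
  the sum over histories.\<close>

lemma prob_in_degree_stays:
  assumes t: "t \<ge> 1" and "k \<ge> 1"
    and local: "\<And>g g'. (\<And>s. s \<in> {1..t} \<Longrightarrow> g s = g' s) \<Longrightarrow> P g = P g'"
    and deg: "\<And>g. P g \<Longrightarrow> in_degree (g t) i = k"
    and P: "{\<omega> \<in> space M. P (\<lambda>s. G s \<omega>)} \<in> events"
  shows "\<P>(\<omega> in M. P (\<lambda>s. G s \<omega>) \<and> in_degree (G (t + 1) \<omega>) i = k)
    = (1 - (1 - \<alpha>) * real k / real t) * \<P>(\<omega> in M. P (\<lambda>s. G s \<omega>))"
proof -
  let ?S = "PiE {1..t} (\<lambda>s. simon_states (s - 1))"
  let ?H = "\<lambda>g \<omega>. \<forall>s\<in>{1..t}. G s \<omega> = g s"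
  let ?c = "1 - (1 - \<alpha>) * real k / real t"
  let ?D = "\<lambda>\<omega>. in_degree (G (t + 1) \<omega>) i = k"
  have D: "{\<omega> \<in> space M. ?D \<omega>} \<in> events" using t by (intro events_at) simp
  have m: "{\<omega> \<in> space M. P (\<lambda>s. G s \<omega>) \<and> ?D \<omega>} \<in> events"
    using D P by (rule sets.sets_Collect_conj)
  have "\<P>(\<omega> in M. P (\<lambda>s. G s \<omega>) \<and> ?D \<omega>)
      = (\<Sum>g\<in>?S. \<P>(\<omega> in M. ?H g \<omega> \<and> P (\<lambda>s. G s \<omega>) \<and> ?D \<omega>))"
    by (rule history_sum[OF AE_states finite_simon_states m])
  also have "\<dots> = (\<Sum>g\<in>?S. ?c * \<P>(\<omega> in M. ?H g \<omega> \<and> P (\<lambda>s. G s \<omega>)))"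
  proof (rule sum.cong[OF refl])
    fix g assume g: "g \<in> ?S"
    then have "g t \<in> simon_states (t - 1)" using t by auto
    then have sh: "simon_shape t (g t)" using simon_shape_states[of "g t" "t - 1"] t by simp
    have eq: "P (\<lambda>s. G s \<omega>) = P g" if "?H g \<omega>" for \<omega> using that by (intro local) auto
    show "\<P>(\<omega> in M. ?H g \<omega> \<and> P (\<lambda>s. G s \<omega>) \<and> ?D \<omega>) = ?c * \<P>(\<omega> in M. ?H g \<omega> \<and> P (\<lambda>s. G s \<omega>))"
    proof (cases "P g")
      case False
      then show ?thesis using eq by (simp cong: conj_cong)
    next
      case True
      let ?n = "card (verts (g t))"
      have dk: "in_degree (g t) i = k" using deg[OF True] .
      then have "i \<in> verts (g t)" using in_degree_pos_imp_vertex[OF sh] \<open>k \<ge> 1\<close> by auto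
      moreover have "verts (g t) = {1..?n}" using sh unfolding simon_shape_def by blast
      ultimately have i: "i \<in> {1..?n}" by blast
      let ?E = "{\<omega> \<in> space M. ?H g \<omega> \<and> G (t + 1) \<omega> = simon_next (g t) i}"
      let ?F = "{\<omega> \<in> space M. ?H g \<omega>}"
      have F: "?F \<in> events" by (rule events_history)
      have E: "?E \<in> events" using t by (intro sets.sets_Collect_conj events_history events_at) simp
      \<comment> \<open>Up to a null set, staying at \<open>k\<close> is the complement, within the
        history, of the single transition with head \<open>i\<close>.\<close>
      have "prob {\<omega> \<in> space M. ?H g \<omega> \<and> ?D \<omega>} = prob (?F - ?E)"
      proof (rule finite_measure_eq_AE)
        show "AE \<omega> in M. (\<omega> \<in> {\<omega> \<in> space M. ?H g \<omega> \<and> ?D \<omega>}) = (\<omega> \<in> ?F - ?E)"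
          using AE_path
        proof eventually_elim
          case (elim \<omega>)
          show ?case
          proof (cases "?H g \<omega>")
            case True
            then have "G (t + 1) \<omega> \<in> simon_succ (g t)" using elim t by fastforce
            then obtain j where j: "j \<in> {1..?n + 1}" "G (t + 1) \<omega> = simon_next (g t) j"
              by (auto simp: simon_succ_def)
            have "?D \<omega> \<longleftrightarrow> i \<noteq> j" using in_degree_simon_next[OF sh j(1), of i] j(2) dk by auto
            moreover have "simon_next (g t) j = simon_next (g t) i \<longleftrightarrow> i = j"
              using inj_on_eq_iff[OF inj_on_simon_next[OF sh], of j i] i j(1) by auto
            ultimately show ?thesis using j by auto
          qed auto
        qed
      qed (use E F D in \<open>auto intro!: sets.sets_Collect_conj sets.Diff simp del: One_nat_def\<close>)
      also have "\<dots> = prob ?F - prob ?E"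
        using E F by (intro finite_measure_Diff) auto
      also have "prob ?E = (1 - \<alpha>) * real k / real t * prob ?F"
        using prob_next[where g = g and j = i, OF t sh] i dk by auto
      finally have "prob {\<omega> \<in> space M. ?H g \<omega> \<and> ?D \<omega>} = ?c * prob ?F"
        by (simp add: algebra_simps)
      then show ?thesis using eq True by (simp cong: conj_cong)
    qed
  qed
  also have "\<dots> = ?c * (\<Sum>g\<in>?S. \<P>(\<omega> in M. ?H g \<omega> \<and> P (\<lambda>s. G s \<omega>)))"
    by (simp only: sum_distrib_left)
  also have "(\<Sum>g\<in>?S. \<P>(\<omega> in M. ?H g \<omega> \<and> P (\<lambda>s. G s \<omega>))) = \<P>(\<omega> in M. P (\<lambda>s. G s \<omega>))"
    by (rule history_sum[OF AE_states finite_simon_states P, symmetric])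
  finally show ?thesis .
qed

section \<open>The law of the waiting time given the hitting time\<close>

lemma events_hit_time:
  assumes "s \<ge> 1"
  shows "{\<omega> \<in> space M. hit_time G i j \<omega> = enat s} \<in> events"
  unfolding hit_time_eq_iff[OF assms] using assms
  by (intro sets.sets_Collect_conj events_at events_Ball) auto

text \<open>Each step in which the in-degree stays at \<open>k\<close> contributes one factor by
  \<open>prob_in_degree_stays\<close>. For \<open>n = 0\<close> the hitting time already fixes the
  in-degree at \<open>s\<close>.\<close>

lemma prob_in_degree_constant:
  assumes s: "s \<ge> 1" and k: "k \<ge> 1"
  shows "\<P>(\<omega> in M. hit_time G i (k - 1) \<omega> = enat s \<and> (\<forall>m\<in>{s..s+n}. in_degree (G m \<omega>) i = k))
    = (\<Prod>m=s..<s+n. 1 - (1 - \<alpha>) * real k / real m) * \<P>(\<omega> in M. hit_time G i (k - 1) \<omega> = enat s)"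
proof (induction n)
  case 0
  have "hit_time G i (k - 1) \<omega> = enat s \<and> (\<forall>m\<in>{s..s+0}. in_degree (G m \<omega>) i = k)
      \<longleftrightarrow> hit_time G i (k - 1) \<omega> = enat s" for \<omega>
    using s k by (auto simp: hit_time_eq_iff)
  then show ?case by simp
next
  case (Suc n)
  \<comment> \<open>The hitting time is spelled out so that \<open>P\<close> is a predicate on
    arbitrary histories; \<open>k - 1 + 1\<close> keeps the form given by
    \<open>hit_time_eq_iff\<close>.\<close>
  define P where "P g \<longleftrightarrow> (in_degree (g s) i = k - 1 + 1 \<and> (\<forall>m\<in>{1..<s}. in_degree (g m) i \<noteq> k - 1 + 1))
      \<and> (\<forall>m\<in>{s..s+n}. in_degree (g m) i = k)" for g :: "nat \<Rightarrow> simon_graph"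
  have P: "P (\<lambda>s. G s \<omega>) \<longleftrightarrow>
      hit_time G i (k - 1) \<omega> = enat s \<and> (\<forall>m\<in>{s..s+n}. in_degree (G m \<omega>) i = k)" for \<omega>
    unfolding P_def hit_time_eq_iff[OF s] ..
  have m: "{\<omega> \<in> space M. P (\<lambda>s. G s \<omega>)} \<in> events"
    unfolding P_def using s by (intro sets.sets_Collect_conj events_at events_Ball) auto
  have "{s..s + Suc n} = insert (s + n + 1) {s..s+n}" by auto
  then have "\<P>(\<omega> in M. hit_time G i (k - 1) \<omega> = enat s \<and> (\<forall>m\<in>{s..s + Suc n}. in_degree (G m \<omega>) i = k))
      = \<P>(\<omega> in M. P (\<lambda>s. G s \<omega>) \<and> in_degree (G (s + n + 1) \<omega>) i = k)"
    unfolding P by (simp add: conj_ac)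
  also have "\<dots> = (1 - (1 - \<alpha>) * real k / real (s + n)) * \<P>(\<omega> in M. P (\<lambda>s. G s \<omega>))"
  proof (rule prob_in_degree_stays[OF _ k _ _ m])
    fix g g' :: "nat \<Rightarrow> simon_graph"
    assume "\<And>r. r \<in> {1..s+n} \<Longrightarrow> g r = g' r"
    then have "g s = g' s" "\<forall>m\<in>{1..<s}. g m = g' m" "\<forall>m\<in>{s..s+n}. g m = g' m" using s by auto
    then show "P g = P g'" by (auto simp: P_def)
  qed (use s in \<open>auto simp: P_def\<close>)
  finally show ?case using Suc unfolding P by simp
qed

text \<open>Given the hitting time, waiting longer than \<open>x\<close> means almost surely that
  the in-degree is still \<open>k\<close> at time \<open>s + nat \<lfloor>x\<rfloor>\<close>. The
  complement is taken inside the conditioning event.\<close>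

lemma prob_waiting_time:
  assumes s: "s \<ge> 1" and k: "k \<ge> 1" and x: "0 < x"
    and pos: "\<P>(\<omega> in M. hit_time G i (k - 1) \<omega> = enat s) > 0"
  shows "\<P>(\<omega> in M. ereal_of_enat (waiting_time G i k \<omega>) \<le> ereal x \<bar> hit_time G i (k - 1) \<omega> = enat s)
    = 1 - (\<Prod>m=s..<s + nat \<lfloor>x\<rfloor>. 1 - (1 - \<alpha>) * real k / real m)"
proof -
  define n where "n = nat \<lfloor>x\<rfloor>"
  let ?F = "{\<omega> \<in> space M. hit_time G i (k - 1) \<omega> = enat s}"
  let ?E = "{\<omega> \<in> space M. hit_time G i (k - 1) \<omega> = enat s \<and> (\<forall>m\<in>{s..s+n}. in_degree (G m \<omega>) i = k)}"
  have F: "?F \<in> events" by (rule events_hit_time[OF s])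
  have "{\<omega> \<in> space M. \<forall>m\<in>{s..s+n}. in_degree (G m \<omega>) i = k} \<in> events"
    using s by (intro events_Ball) auto
  then have E: "?E \<in> events" using F by (intro sets.sets_Collect_conj)
  have eq: "{\<omega> \<in> space M. ereal_of_enat (waiting_time G i k \<omega>) \<le> ereal x \<and> hit_time G i (k - 1) \<omega> = enat s}
      = {\<omega> \<in> space M. (\<exists>m\<in>{1..s+n}. in_degree (G m \<omega>) i = k + 1) \<and> hit_time G i (k - 1) \<omega> = enat s}"
    using waiting_time_le_iff[where G = G, OF _ x] unfolding hit_time_le_iff n_def[symmetric] by blast
  have "{\<omega> \<in> space M. \<exists>m\<in>{1..s+n}. in_degree (G m \<omega>) i = k + 1} \<in> events"
    by (intro sets.sets_Collect_finite_Ex events_at) auto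
  then have W: "{\<omega> \<in> space M. ereal_of_enat (waiting_time G i k \<omega>) \<le> ereal x
      \<and> hit_time G i (k - 1) \<omega> = enat s} \<in> events"
    unfolding eq using F by (intro sets.sets_Collect_conj)
  have "prob {\<omega> \<in> space M. ereal_of_enat (waiting_time G i k \<omega>) \<le> ereal x
      \<and> hit_time G i (k - 1) \<omega> = enat s} = prob (?F - ?E)"
  proof (rule finite_measure_eq_AE[OF _ W])
    show "AE \<omega> in M. (\<omega> \<in> {\<omega> \<in> space M. ereal_of_enat (waiting_time G i k \<omega>) \<le> ereal x
      \<and> hit_time G i (k - 1) \<omega> = enat s}) = (\<omega> \<in> ?F - ?E)"
      using AE_path
    proof eventually_elim
      case (elim \<omega>)
      show ?case
      proof (cases "hit_time G i (k - 1) \<omega> = enat s")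
        case True
        then have "in_degree (G s \<omega>) i = k" using s k by (simp add: hit_time_eq_iff)
        then show ?thesis
          using True waiting_time_le_iff[OF True x] hit_time_gt_iff[of G \<omega> s i k n] elim s
          by (auto simp: n_def)
      qed auto
    qed
  qed (use E F in auto)
  also have "\<dots> = prob ?F - prob ?E"
    using E F by (intro finite_measure_Diff) auto
  also have "prob ?E = (\<Prod>m=s..<s+n. 1 - (1 - \<alpha>) * real k / real m) * prob ?F"
    by (rule prob_in_degree_constant[OF s k])
  finally show ?thesis
    using pos unfolding cond_prob_def n_def by (simp add: field_simps)
qed

text \<open>A graph with \<open>s\<close> arcs has no in-degree above \<open>s\<close>. This
  supplies the condition \<open>c \<le> real s\<close> of the analytic estimate.\<close>

lemma in_degree_le_hit_time:
  assumes s: "s \<ge> 1" and k: "k \<ge> 1"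
    and pos: "\<P>(\<omega> in M. hit_time G i (k - 1) \<omega> = enat s) > 0"
  shows "k \<le> s"
proof (rule ccontr)
  assume "\<not> k \<le> s"
  have "AE \<omega> in M. \<not> hit_time G i (k - 1) \<omega> = enat s"
    using AE_path
  proof eventually_elim
    case (elim \<omega>)
    then have "in_degree (G s \<omega>) i \<le> s" using in_degree_le s by blast
    then show ?case using \<open>\<not> k \<le> s\<close> k by (simp add: hit_time_eq_iff[OF s])
  qed
  then have "\<P>(\<omega> in M. hit_time G i (k - 1) \<omega> = enat s) = 0"
    using prob_eq_0[OF events_hit_time[OF s]] by simp
  then show False using pos by simp
qed

end

section \<open>Uniform comparison of the two distribution functions\<close>

theorem theorem4p3:
  fixes M :: "'w measure" and N :: "'z measure" and \<alpha> :: real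
    and G :: "nat \<Rightarrow> 'w \<Rightarrow> simon_graph" and Z :: "nat \<Rightarrow> nat \<Rightarrow> 'z \<Rightarrow> real"
  assumes "0 < \<alpha>" and "\<alpha> < 1"
    and "simon_model M \<alpha> G"
    and "prob_space N"
    and "\<And>i k. i \<ge> 1 \<Longrightarrow> k \<ge> 1 \<Longrightarrow>
           distributed N lborel (Z i k) (exponential_density ((1 - \<alpha>) * real k))"
  shows "\<forall>k\<ge>1. \<exists>R\<in>O(\<lambda>s::nat. 1 / real s). \<forall>i\<ge>1. \<forall>s\<ge>2.
           \<P>(\<omega> in M. hit_time G i (k - 1) \<omega> = enat s) > 0 \<longrightarrow>
           (\<forall>x>0. let z = ln (1 + x / (real s - 1)) in
              \<bar>\<P>(\<omega> in M. ereal_of_enat (waiting_time G i k \<omega>) \<le> ereal x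
                        \<bar> hit_time G i (k - 1) \<omega> = enat s)
                 - \<P>(\<omega> in N. Z i k \<omega> \<le> z)\<bar> < (R s :: real))"
proof (intro allI impI)
  fix k :: nat assume k: "k \<ge> 1"
  interpret simon_model M \<alpha> G by fact
  interpret N: prob_space N by fact
  define c where "c = (1 - \<alpha>) * real k"
  have c: "0 < c" "c \<le> real k" using assms(1,2) k by (auto simp: c_def mult_left_le_one_le)
  \<comment> \<open>\<open>R\<close> involves only \<open>\<alpha>\<close> and \<open>k\<close>, so
    the bound is uniform in \<open>i\<close> and \<open>x\<close>. The additional 1 in the numerator
    makes the inequality strict.\<close>
  define R where "R s = (2 * (c\<^sup>2 + 3 * c) + 1) / real s" for s :: nat
  show "\<exists>R\<in>O(\<lambda>s::nat. 1 / real s). \<forall>i\<ge>1. \<forall>s\<ge>2.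
           \<P>(\<omega> in M. hit_time G i (k - 1) \<omega> = enat s) > 0 \<longrightarrow>
           (\<forall>x>0. let z = ln (1 + x / (real s - 1)) in
              \<bar>\<P>(\<omega> in M. ereal_of_enat (waiting_time G i k \<omega>) \<le> ereal x
                        \<bar> hit_time G i (k - 1) \<omega> = enat s)
                 - \<P>(\<omega> in N. Z i k \<omega> \<le> z)\<bar> < (R s :: real))"
  proof (rule bexI[of _ R], intro allI impI)
    show "R \<in> O(\<lambda>s. 1 / real s)"
      by (rule bigoI[of _ "2 * (c\<^sup>2 + 3 * c) + 1"]) (use c in \<open>simp add: R_def\<close>)
  next
    fix i s :: nat and x :: real
    assume i: "i \<ge> 1" and s: "s \<ge> 2" and x: "x > 0"
      and pos: "\<P>(\<omega> in M. hit_time G i (k - 1) \<omega> = enat s) > 0"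
    have s1: "s \<ge> 1" using s by simp
    have "c \<le> real s" using c in_degree_le_hit_time[OF s1 k pos] by linarith
    define z where "z = ln (1 + x / (real s - 1))"
    \<comment> \<open>The formula \<open>1 - exp (- z * c)\<close> for the exponential distribution
      function is valid for nonnegative arguments.\<close>
    have "z \<ge> 0" using s x by (simp add: z_def)
    then have Z: "\<P>(\<omega> in N. Z i k \<omega> \<le> z) = 1 - exp (- z * c)"
      using N.exponential_distributedD_le[OF assms(5)[OF i k]] c by (simp add: c_def)
    have W: "\<P>(\<omega> in M. ereal_of_enat (waiting_time G i k \<omega>) \<le> ereal x \<bar> hit_time G i (k - 1) \<omega> = enat s)
        = 1 - (\<Prod>m=s..<s + nat \<lfloor>x\<rfloor>. 1 - c / real m)"
      using prob_waiting_time[OF s1 k x pos] by (simp add: c_def)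
    have "\<bar>(\<Prod>m=s..<s + nat \<lfloor>x\<rfloor>. 1 - c / real m) - exp (- z * c)\<bar> \<le> 2 * (c\<^sup>2 + 3 * c) / real s"
      unfolding z_def using c s x \<open>c \<le> real s\<close> by (intro prod_approx_exponential_tail) auto
    also have "\<dots> < R s" using s by (simp add: R_def divide_strict_right_mono)
    \<comment> \<open>Both probabilities are 1 minus a tail, so their difference is, up to sign,
      that of the tails.\<close>
    finally show "let z = ln (1 + x / (real s - 1)) in
        \<bar>\<P>(\<omega> in M. ereal_of_enat (waiting_time G i k \<omega>) \<le> ereal x \<bar> hit_time G i (k - 1) \<omega> = enat s)
           - \<P>(\<omega> in N. Z i k \<omega> \<le> z)\<bar> < R s"
      unfolding Let_def z_def[symmetric] Z W by linarith
  qed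
qed

end
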